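(* Let $J_1,J_2$ be Bessel functions of the first kind. Then $$\left[\frac{J_1(2)}{J_2(2)}\right]_q=\frac{J_1(2)_q}{J_2(2)_q},$$ where for $m\in\{1,2\}$ $$J_m(2)_q:=\sum_{n=0}^\infty\frac{(-1)^nq^{n(n+m-1)}}{[n]_q!\,[n+m]_q!},\qquad [n]_q!:=\prod_{j=1}^n[j]_q.$$
   Context: $[j]_q=\frac{1-q^j}{1-q}$. The Bessel function is $J_\nu(z)=\sum_{n\ge0}\frac{(-1)^n}{n!\,\Gamma(n+\nu+1)}\left(\frac z2\right)^{2n+\nu}$, so $J_m(2)=\sum_{n\ge0}\frac{(-1)^n}{n!(n+m)!}$; the ratio $J_1(2)/J_2(2)\approx1.636$ is a real number greater than $1$. For real $x\ge1$ write uniquely $x=[[c_1,c_2,\ldots]]:=c_1-\frac{1}{c_2-\frac{1}{c_3-\cdots}}$ with integers $c_j\ge2$; then the $q$-real number $[x]_q\in\mathbb Z[[q]]$ is the $q$-adic limit as $N\to\infty$ of $[c_1]_q-\frac{q^{c_1-1}}{[c_2]_q-\cdots\frac{q^{c_{N-1}-1}}{[c_N]_q}}$. The identity is an identity of formal power series in $q$ (the series defining $J_m(2)_q$ converge $q$-adically). *)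

theory Defs
  imports "HOL-Analysis.Analysis" "HOL-Computational_Algebra.Formal_Power_Series"
begin

text \<open>
  The variable \<open>q\<close> is \<^term>\<open>fps_X\<close>. Formal power series are taken over the field of rational
  numbers, so that the library division is available; all denominators below have constant
  term 1, so no quotient leaves the subring of series with integer coefficients. The topology
  on \<^typ>\<open>rat fps\<close> underlying \<^const>\<open>lim\<close> and \<^const>\<open>suminf\<close> is the
  \<open>q\<close>-adic one.
\<close>

definition q_int :: "nat \<Rightarrow> rat fps" where
  "q_int j = (1 - fps_X ^ j) / (1 - fps_X)"

definition q_fact :: "nat \<Rightarrow> rat fps" where
  "q_fact n = (\<Prod>j=1..n. q_int j)"

text \<open>
  Coefficient sequences are indexed from 0, so \<open>c j\<close> is the coefficient \<open>c\<^sub>j\<^sub>+\<^sub>1\<close> of the usual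
  notation, and the truncation with index \<open>N\<close> involves the \<open>N + 1\<close> coefficients
  \<open>c 0, \<dots>, c N\<close>.
\<close>

primrec neg_cf :: "(nat \<Rightarrow> nat) \<Rightarrow> nat \<Rightarrow> real" where
  "neg_cf c 0 = real (c 0)"
| "neg_cf c (Suc N) = real (c 0) - 1 / neg_cf (\<lambda>j. c (Suc j)) N"

definition is_neg_cf_expansion :: "(nat \<Rightarrow> nat) \<Rightarrow> real \<Rightarrow> bool" where
  "is_neg_cf_expansion c x \<longleftrightarrow> (\<forall>j. c j \<ge> 2) \<and> neg_cf c \<longlonglongrightarrow> x"

primrec q_neg_cf :: "(nat \<Rightarrow> nat) \<Rightarrow> nat \<Rightarrow> rat fps" where
  "q_neg_cf c 0 = q_int (c 0)"
| "q_neg_cf c (Suc N) =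
     q_int (c 0) - fps_X ^ (c 0 - 1) / q_neg_cf (\<lambda>j. c (Suc j)) N"

text \<open>
  Meaningful for \<open>x \<ge> 1\<close>, where exactly one expansion exists. Expansions are always infinite;
  those of rational numbers end in \<open>2, 2, 2, \<dots>\<close>.
\<close>

definition q_real :: "real \<Rightarrow> rat fps" where
  "q_real x = lim (q_neg_cf (THE c. is_neg_cf_expansion c x))"

text \<open>
  Meaningful for \<open>z > 0\<close>, because of the real power. At the poles of \<^const>\<open>Gamma\<close>
  the quotient is 0, in accordance with the convention for the reciprocal Gamma function.
\<close>

definition bessel_J :: "real \<Rightarrow> real \<Rightarrow> real" where
  "bessel_J \<nu> z =
     (\<Sum>n. (-1) ^ n / (fact n * Gamma (real n + \<nu> + 1)) * (z / 2) powr (2 * real n + \<nu>))"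

text \<open>The series \<open>J\<^sub>m(2)\<^sub>q\<close>, for \<open>m \<ge> 1\<close>.\<close>

definition q_bessel_J_two :: "nat \<Rightarrow> rat fps" where
  "q_bessel_J_two m =
     (\<Sum>n. (-1) ^ n * fps_X ^ (n * (n + m - 1)) / (q_fact n * q_fact (n + m)))"

end

theory Submission
  imports Defs
begin

text \<open>
  Both sides are the same continued fraction. Combining the defining series term by term
  gives the three-term recurrences
  \<open>J\<^sub>m(2) = (m + 1) J\<^sub>m\<^sub>+\<^sub>1(2) - J\<^sub>m\<^sub>+\<^sub>2(2)\<close> and
  \<open>J\<^sub>m(2)\<^sub>q = [m + 1]\<^sub>q J\<^sub>m\<^sub>+\<^sub>1(2)\<^sub>q - q\<^sup>m J\<^sub>m\<^sub>+\<^sub>2(2)\<^sub>q\<close>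
  (lemmas \<open>bessel_J_two_recurrence\<close> and \<open>q_bessel_J_two_recurrence\<close>).
  Divided by the middle term they say that the quotients of consecutive values satisfy
  \<open>y\<^sub>m = (m + 1) - 1 / y\<^sub>m\<^sub>+\<^sub>1\<close> and
  \<open>Y\<^sub>m = [m + 1]\<^sub>q - q\<^sup>m / Y\<^sub>m\<^sub>+\<^sub>1\<close>. Iterated from
  \<open>m = 1\<close>, the first is the negative continued fraction with coefficients \<open>2, 3, 4, \<dots>\<close>,
  and the second is exactly its \<open>q\<close>-deformation, because the coefficient \<open>c = m + 1\<close>
  comes with the power \<open>q\<^sup>c\<^sup>-\<^sup>1\<close>.

  It remains to see that the formal iterations converge to the quotients. Over the reals this
  needs only that all tails \<open>y\<^sub>m\<close> are at least 1 (\<open>neg_cf_tendsto\<close>), which holds because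
  \<open>J\<^sub>m(2)\<close> is positive and decreasing in \<open>m \<ge> 1\<close>, by the alternating series bounds;
  \<open>q\<close>-adically every step of the fraction multiplies the error by a positive power of
  \<open>q\<close> (\<open>q_neg_cf_tendsto\<close>). Finally, the \<open>q\<close>-real number is built from \<^emph>\<open>the\<close> expansion of
  the real number, so uniqueness of expansions is needed (\<open>is_neg_cf_expansion_unique\<close>).
\<close>

unbundle no vec_syntax
unbundle fps_syntax

section \<open>Negative continued fractions of real numbers\<close>

text \<open>
  The bound is attained by the constant sequence \<open>2, 2, 2, \<dots>\<close>, whose truncations are
  \<open>2, 3/2, 4/3, \<dots>\<close>; larger coefficients only increase the value.
\<close>
lemma neg_cf_ge:
  assumes "\<And>j. c j \<ge> 2"
  shows "neg_cf c N \<ge> (real N + 2) / (real N + 1)"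
  using assms
proof (induction N arbitrary: c)
  case 0
  have "real (c 0) \<ge> 2" using 0[of 0] by linarith
  then show ?case by simp
next
  case (Suc N)
  have c0: "real (c 0) \<ge> 2" using Suc.prems[of 0] by linarith
  have "neg_cf (\<lambda>j. c (Suc j)) N \<ge> (real N + 2) / (real N + 1)"
    by (rule Suc.IH) (rule Suc.prems)
  then have "1 / neg_cf (\<lambda>j. c (Suc j)) N \<le> 1 / ((real N + 2) / (real N + 1))"
    by (intro divide_left_mono mult_pos_pos) (auto intro: less_le_trans[rotated])
  also have "\<dots> = 2 - (real (Suc N) + 2) / (real (Suc N) + 1)"
    by (simp add: field_simps)
  finally show ?case using c0 by simp
qed

lemma neg_cf_ge_1:
  assumes "\<And>j. c j \<ge> 2"
  shows "neg_cf c N \<ge> 1"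
proof -
  have "1 \<le> (real N + 2) / (real N + 1)" by simp
  also have "\<dots> \<le> neg_cf c N" using assms by (rule neg_cf_ge)
  finally show ?thesis .
qed

lemma neg_cf_le:
  assumes "\<And>j. c j \<ge> 2"
  shows "neg_cf c N \<le> real (c 0)"
proof (cases N)
  case (Suc n)
  have "neg_cf (\<lambda>j. c (Suc j)) n \<ge> 1"
    by (rule neg_cf_ge_1) (rule assms)
  then show ?thesis using Suc by simp
qed simp

text \<open>
  One step of the fraction maps a pair \<open>a, z\<close> of tails to values that differ by
  \<open>(a - z) / (a z)\<close>. As \<open>z \<ge> 1\<close>, the error shrinks at least by the factor \<open>a\<close>, and by
  \<open>neg_cf_ge\<close> the product of these factors telescopes to at least \<open>N + 1\<close>. No geometric rate
  is possible here, because of the coefficients \<open>2, 2, 2, \<dots>\<close>.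
\<close>
lemma neg_cf_error:
  assumes "\<And>j. c j \<ge> 2" "\<And>j. y j \<ge> 1" "\<And>j. y j = real (c j) - 1 / y (Suc j)"
  shows "\<bar>neg_cf c N - y 0\<bar> \<le> 1 / (real N + 1)"
  using assms
proof (induction N arbitrary: c y)
  case 0
  show ?case using "0.prems"(2)[of 1] "0.prems"(3)[of 0] by simp
next
  case (Suc N)
  define a where "a = neg_cf (\<lambda>j. c (Suc j)) N"
  define z where "z = y (Suc 0)"
  have a: "a \<ge> (real N + 2) / (real N + 1)"
    unfolding a_def by (rule neg_cf_ge) (rule Suc.prems)
  have "(real N + 2) / (real N + 1) > 0" by simp
  with a have a_pos: "a > 0" by linarith
  have z: "z \<ge> 1" unfolding z_def by (rule Suc.prems)
  have IH: "\<bar>a - z\<bar> \<le> 1 / (real N + 1)"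
    unfolding a_def z_def by (rule Suc.IH[of "\<lambda>j. c (Suc j)" "\<lambda>j. y (Suc j)"]) (rule Suc.prems)+
  have "neg_cf c (Suc N) - y 0 = 1 / z - 1 / a"
    using Suc.prems(3)[of 0] by (simp add: a_def z_def)
  also have "\<dots> = (a - z) / (a * z)"
    using a_pos z by (simp add: field_simps)
  finally have "neg_cf c (Suc N) - y 0 = (a - z) / (a * z)" .
  then have "\<bar>neg_cf c (Suc N) - y 0\<bar> = \<bar>a - z\<bar> / (a * z)"
    using a_pos z by (simp add: abs_mult)
  also have "\<dots> \<le> (1 / (real N + 1)) / ((real N + 2) / (real N + 1) * 1)"
    using IH a z a_pos by (intro frac_le mult_mono) auto
  also have "\<dots> = 1 / (real (Suc N) + 1)" by (simp add: field_simps)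
  finally show ?case .
qed

lemma neg_cf_tendsto:
  assumes "\<And>j. c j \<ge> 2" "\<And>j. y j \<ge> 1" "\<And>j. y j = real (c j) - 1 / y (Suc j)"
  shows "neg_cf c \<longlonglongrightarrow> y 0"
proof (rule LIM_zero_cancel, rule Lim_null_comparison)
  show "\<forall>\<^sub>F N in sequentially. norm (neg_cf c N - y 0) \<le> 1 / (real N + 1)"
    unfolding real_norm_def by (intro always_eventually allI neg_cf_error assms)
  show "(\<lambda>N. 1 / (real N + 1)) \<longlonglongrightarrow> 0"
    using LIMSEQ_inverse_real_of_nat by (simp add: divide_inverse add.commute)
qed

text \<open>
  All tails lie in \<open>[1, c\<^sub>1]\<close>, so the limit lies in \<open>[c\<^sub>0 - 1, c\<^sub>0 - 1 / c\<^sub>1]\<close>. Hence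
  the number determines its first coefficient and the value of the remaining expansion, which is
  what the induction for uniqueness needs.
\<close>
lemma is_neg_cf_expansion_step:
  assumes "is_neg_cf_expansion c x"
  shows "int (c 0) = \<lfloor>x\<rfloor> + 1"
    and "is_neg_cf_expansion (\<lambda>j. c (Suc j)) (1 / (real (c 0) - x))"
proof -
  have c: "\<And>j. c j \<ge> 2" and lim: "neg_cf c \<longlonglongrightarrow> x"
    using assms by (auto simp: is_neg_cf_expansion_def)
  define a where "a = neg_cf (\<lambda>j. c (Suc j))"
  have a1: "a N \<ge> 1" for N unfolding a_def by (rule neg_cf_ge_1) (rule c)
  have a2: "a N \<le> real (c 1)" for N
    using neg_cf_le[of "\<lambda>j. c (Suc j)"] c by (simp add: a_def)
  have "(\<lambda>N. neg_cf c (Suc N)) \<longlonglongrightarrow> x"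
    using lim by (rule LIMSEQ_Suc)
  then have lim': "(\<lambda>N. real (c 0) - 1 / a N) \<longlonglongrightarrow> x"
    by (simp add: a_def)
  have ge: "real (c 0) - 1 \<le> x"
    by (rule LIMSEQ_le_const[OF lim']) (use a1 in \<open>auto simp: divide_le_eq_1 intro: less_le_trans[OF zero_less_one]\<close>)
  have "x \<le> real (c 0) - 1 / real (c 1)"
  proof (rule LIMSEQ_le_const2[OF lim'], intro exI allI impI)
    fix N
    have "1 / real (c 1) \<le> 1 / a N"
      using a1[of N] a2[of N] by (intro divide_left_mono mult_pos_pos) linarith+
    then show "real (c 0) - 1 / a N \<le> real (c 0) - 1 / real (c 1)" by simp
  qed
  moreover have "1 / real (c 1) > 0" using c[of 1] by simp
  ultimately have lt: "x < real (c 0)" by linarith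
  show "int (c 0) = \<lfloor>x\<rfloor> + 1"
    using ge lt by linarith
  have "(\<lambda>N. 1 / (real (c 0) - (real (c 0) - 1 / a N))) \<longlonglongrightarrow> 1 / (real (c 0) - x)"
    using lt by (intro tendsto_intros lim') simp
  then have "a \<longlonglongrightarrow> 1 / (real (c 0) - x)" by simp
  then show "is_neg_cf_expansion (\<lambda>j. c (Suc j)) (1 / (real (c 0) - x))"
    using c by (simp add: is_neg_cf_expansion_def a_def)
qed

lemma is_neg_cf_expansion_unique:
  assumes "is_neg_cf_expansion c x" "is_neg_cf_expansion d x"
  shows "c = d"
proof
  fix j
  show "c j = d j" using assms
  proof (induction j arbitrary: c d x)
    case 0
    then show ?case
      using is_neg_cf_expansion_step(1)[of c x] is_neg_cf_expansion_step(1)[of d x] by simp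
  next
    case (Suc j)
    have "c 0 = d 0"
      using is_neg_cf_expansion_step(1)[of c x] is_neg_cf_expansion_step(1)[of d x] Suc.prems
      by simp
    then show ?case
      using Suc.IH[of "\<lambda>j. c (Suc j)" "1 / (real (c 0) - x)" "\<lambda>j. d (Suc j)"]
        is_neg_cf_expansion_step(2) Suc.prems by metis
  qed
qed

section \<open>The expansion of the Bessel quotient\<close>

text \<open>
  At argument 2 the powers in the Bessel series are all 1, which leaves an alternating series whose
  terms do not increase in absolute value; the two bounds are its first two partial sums.
\<close>
lemma bessel_J_two_leibniz:
  fixes m :: nat
  defines "a \<equiv> \<lambda>n. 1 / (fact n * fact (n + m)) :: real"
  shows "(\<lambda>n. (-1) ^ n * a n) sums bessel_J (real m) 2"
    and "1 / fact m - 1 / fact (Suc m) \<le> bessel_J (real m) 2"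
    and "bessel_J (real m) 2 \<le> 1 / fact m"
proof -
  have "Gamma (real n + real m + 1) = fact (n + m)" for n
    using Gamma_fact[of "n + m", where 'a = real] by (simp add: add_ac)
  then have J: "bessel_J (real m) 2 = (\<Sum>n. (-1) ^ n * a n)"
    by (simp add: bessel_J_def a_def)
  have pos: "0 \<le> a n" for n by (simp add: a_def)
  have mono: "a (Suc n) \<le> a n" for n
    unfolding a_def by (intro divide_left_mono mult_mono) (auto intro!: fact_mono mult_pos_pos simp del: fact_Suc)
  have "a n \<le> 1 / fact n" for n
    unfolding a_def by (intro divide_left_mono) (auto intro!: mult_pos_pos simp: fact_ge_1)
  moreover have "(\<lambda>n. 1 / fact n :: real) \<longlonglongrightarrow> 0"
    using summable_LIMSEQ_zero[OF summable_exp[of "1::real"]] by (simp add: divide_inverse)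
  ultimately have lim: "a \<longlonglongrightarrow> 0"
    using pos by (intro tendsto_sandwich[of "\<lambda>_. 0" a _ "\<lambda>n. 1 / fact n"]) auto
  note leibniz = summable_Leibniz'[OF lim pos mono]
  show "(\<lambda>n. (-1) ^ n * a n) sums bessel_J (real m) 2"
    unfolding J by (rule summable_sums[OF leibniz(1)])
  show "1 / fact m - 1 / fact (Suc m) \<le> bessel_J (real m) 2"
    using leibniz(2)[of 1] by (simp add: J a_def numeral_2_eq_2)
  show "bessel_J (real m) 2 \<le> 1 / fact m"
    using leibniz(4)[of 0] by (simp add: J a_def)
qed

lemma bessel_J_two_pos:
  assumes "m > 0"
  shows "bessel_J (real m) 2 > 0"
proof -
  have "1 / fact (Suc m) < (1 / fact m :: real)"
    using assms by (intro divide_strict_left_mono) (auto intro!: fact_less_mono simp del: fact_Suc)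
  then show ?thesis using bessel_J_two_leibniz(2)[of m] by linarith
qed

lemma bessel_J_two_antimono:
  assumes "m > 0"
  shows "bessel_J (real (Suc m)) 2 \<le> bessel_J (real m) 2"
proof -
  have "bessel_J (real (Suc m)) 2 \<le> 1 / fact (Suc m)"
    by (rule bessel_J_two_leibniz)
  also have "\<dots> \<le> 1 / fact m - 1 / fact (Suc m)"
  proof -
    have "2 * fact m \<le> (fact (Suc m) :: real)"
      using assms by simp
    then have "2 / fact (Suc m) \<le> 2 / (2 * fact m :: real)"
      by (intro divide_left_mono) (simp_all del: fact_Suc)
    then show ?thesis by (simp del: fact_Suc)
  qed
  also have "\<dots> \<le> bessel_J (real m) 2"
    by (rule bessel_J_two_leibniz)
  finally show ?thesis .
qed

text \<open>
  The term with index \<open>k + 1\<close> on the left combines the terms with indices \<open>k + 1\<close> and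
  \<open>k\<close> of the two series on the right, through the identity
  \<open>k + m + 2 = (m + 1) + (k + 1)\<close> of the numerators over
  the common denominator \<open>(k + 1)! (k + m + 2)!\<close>.
\<close>
lemma bessel_J_two_recurrence:
  "bessel_J (real m) 2 = real (Suc m) * bessel_J (real (Suc m)) 2 - bessel_J (real (m + 2)) 2"
proof -
  define b where "b m n = (-1) ^ n * (1 / (fact n * fact (n + m)) :: real)" for m n :: nat
  have b: "b m sums bessel_J (real m) 2" for m
    unfolding b_def by (rule bessel_J_two_leibniz(1))
  have tail: "(\<lambda>k. b m (Suc k)) sums (bessel_J (real m) 2 - b m 0)" for m
    using b[of m] by (subst sums_Suc_iff) simp
  have step: "b m (Suc k) = real (Suc m) * b (Suc m) (Suc k) - b (m + 2) k" for k
    by (simp add: b_def divide_simps) (simp add: algebra_simps)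
  have "(\<lambda>k. b m (Suc k)) sums
      (real (Suc m) * (bessel_J (real (Suc m)) 2 - b (Suc m) 0) - bessel_J (real (m + 2)) 2)"
    unfolding step by (intro sums_diff sums_mult tail b)
  with tail[of m] have "bessel_J (real m) 2 - b m 0 =
      real (Suc m) * (bessel_J (real (Suc m)) 2 - b (Suc m) 0) - bessel_J (real (m + 2)) 2"
    by (rule sums_unique2)
  moreover have "b m 0 = real (Suc m) * b (Suc m) 0"
    by (simp add: b_def del: of_nat_Suc)
  ultimately show ?thesis by (simp add: right_diff_distrib)
qed

lemma bessel_quotient_expansion:
  "is_neg_cf_expansion (\<lambda>j. j + 2) (bessel_J 1 2 / bessel_J 2 2)"
proof -
  define y where "y j = bessel_J (real (Suc j)) 2 / bessel_J (real (j + 2)) 2" for j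
  have pos: "bessel_J (real (Suc j)) 2 > 0" for j
    by (rule bessel_J_two_pos) simp
  have ge_1: "y j \<ge> 1" for j
    using bessel_J_two_antimono[of "Suc j"] pos[of "Suc j"]
    by (simp add: y_def le_divide_eq_1 add_ac)
  have step: "y j = real (j + 2) - 1 / y (Suc j)" for j
    using bessel_J_two_recurrence[of "Suc j"] pos[of "Suc j"]
    by (simp add: y_def field_simps)
  have "neg_cf (\<lambda>j. j + 2) \<longlonglongrightarrow> y 0"
    by (rule neg_cf_tendsto[where y = y]) (simp, rule ge_1, rule step)
  then show ?thesis by (simp add: is_neg_cf_expansion_def y_def)
qed

section \<open>The q-adic topology\<close>

text \<open>
  Divisibility by powers of the variable is used as congruence in the \<open>q\<close>-adic topology, since
  it is compatible with sums and products.
\<close>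
lemma fps_X_power_dvd_iff:
  fixes f :: "'a :: field fps"
  shows "fps_X ^ n dvd f \<longleftrightarrow> (\<forall>i<n. f $ i = 0)"
proof
  assume "fps_X ^ n dvd f"
  then show "\<forall>i<n. f $ i = 0" by (auto simp: dvd_def fps_X_power_mult_nth)
next
  assume "\<forall>i<n. f $ i = 0"
  then show "fps_X ^ n dvd f"
    by (cases "f = 0") (auto simp: fps_dvd_iff fps_X_power_subdegree intro!: subdegree_geI)
qed

lemma fps_eqI_dvd:
  fixes f g :: "'a :: field fps"
  assumes "\<And>n. fps_X ^ n dvd f - g"
  shows "f = g"
proof (rule fps_ext)
  fix n
  show "f $ n = g $ n"
    using assms[of "Suc n"] by (simp add: fps_X_power_dvd_iff del: power_Suc)
qed

lemma tendsto_fpsI_dvd: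
  fixes f :: "nat \<Rightarrow> 'a :: field fps"
  assumes "\<And>n. fps_X ^ n dvd f n - g"
  shows "f \<longlonglongrightarrow> g"
proof (rule tendsto_fpsI)
  fix i
  show "\<forall>\<^sub>F n in sequentially. f n $ i = g $ i"
    using eventually_gt_at_top[of i]
    by eventually_elim (use assms in \<open>auto simp: fps_X_power_dvd_iff\<close>)
qed

text \<open>
  If the \<open>n\<close>-th term only starts at degree \<open>n\<close>, every coefficient of the sum is a finite
  sum; so the series converges, and the error of a partial sum has high order.
\<close>
lemma suminf_fps_dvd:
  fixes f :: "nat \<Rightarrow> 'a :: field fps"
  assumes "\<And>n. fps_X ^ n dvd f n"
  shows "fps_X ^ N dvd (\<Sum>n<N. f n) - suminf f"
proof -
  define g where "g = Abs_fps (\<lambda>i. \<Sum>n\<le>i. f n $ i)"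
  have dvd: "fps_X ^ N dvd (\<Sum>n<N. f n) - g" for N
    unfolding fps_X_power_dvd_iff
  proof safe
    fix i assume "i < N"
    then have "(\<Sum>n<N. f n $ i) = (\<Sum>n\<le>i. f n $ i)"
      using assms by (intro sum.mono_neutral_right) (auto simp: fps_X_power_dvd_iff)
    then show "((\<Sum>n<N. f n) - g) $ i = 0"
      by (simp add: fps_sum_nth g_def)
  qed
  then have "f sums g"
    unfolding sums_def by (rule tendsto_fpsI_dvd)
  then show ?thesis using dvd sums_unique by blast
qed

section \<open>q-continued fractions\<close>

lemma q_int_eq_sum: "q_int j = (\<Sum>i<j. fps_X ^ i)"
proof -
  have "1 - fps_X ^ j = (1 - fps_X) * (\<Sum>i<j. fps_X ^ i :: rat fps)"
    by (rule one_diff_power_eq)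
  moreover have "1 - fps_X \<noteq> (0 :: rat fps)"
    by (metis fps_X_neq_one right_minus_eq)
  ultimately show ?thesis unfolding q_int_def by simp
qed

lemma q_int_add: "q_int (m + n) = q_int m + fps_X ^ m * q_int n"
proof (induction n)
  case 0
  show ?case by (simp add: q_int_eq_sum)
next
  case (Suc n)
  then show ?case by (simp add: q_int_eq_sum power_add ring_distribs)
qed

lemma q_int_nth_0:
  assumes "j > 0"
  shows "q_int j $ 0 = 1"
proof -
  from assms obtain k where k: "j = Suc k" by (cases j) auto
  have "(\<Sum>i<Suc k. fps_X ^ i $ 0) = (1 :: rat)"
    by (subst sum.lessThan_Suc_shift) simp
  then show ?thesis unfolding k q_int_eq_sum fps_sum_nth .
qed

lemma q_neg_cf_nth_0:
  assumes "\<And>j. c j \<ge> 2"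
  shows "q_neg_cf c N $ 0 = 1"
  using assms
proof (induction N arbitrary: c)
  case 0
  show ?case using 0[of 0] by (simp add: q_int_nth_0)
next
  case (Suc N)
  have "q_neg_cf (\<lambda>j. c (Suc j)) N $ 0 = 1" by (rule Suc.IH) (rule Suc.prems)
  then show ?case using Suc.prems[of 0] by (simp add: q_int_nth_0)
qed

text \<open>
  As over the reals, one step turns the error \<open>A - Z\<close> of the tail into
  \<open>q\<^sup>c\<^sup>-\<^sup>1 (A - Z) / (A Z)\<close>. Here \<open>A\<close> and \<open>Z\<close> are units, and
  \<open>c \<ge> 2\<close> makes the order of the error grow by at least 1.
\<close>
lemma q_neg_cf_error:
  assumes "\<And>j. c j \<ge> 2" "\<And>j. Y j $ 0 = 1"
    and "\<And>j. Y j = q_int (c j) - fps_X ^ (c j - 1) / Y (Suc j)"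
  shows "fps_X ^ Suc N dvd q_neg_cf c N - Y 0"
  using assms
proof (induction N arbitrary: c Y)
  case 0
  have "q_neg_cf c 0 - Y 0 = fps_X ^ (c 0 - 1) / Y (Suc 0)"
    using "0.prems"(3)[of 0] by simp
  also have "\<dots> = fps_X ^ (c 0 - 1) * inverse (Y (Suc 0))"
    by (simp add: fps_divide_unit "0.prems"(2))
  finally have "fps_X ^ (c 0 - 1) dvd q_neg_cf c 0 - Y 0" by simp
  then show ?case
    using "0.prems"(1)[of 0] by (auto intro: power_le_dvd)
next
  case (Suc N)
  define A where "A = q_neg_cf (\<lambda>j. c (Suc j)) N"
  define Z where "Z = Y (Suc 0)"
  have A0: "A $ 0 = 1" unfolding A_def by (rule q_neg_cf_nth_0) (rule Suc.prems)
  have Z0: "Z $ 0 = 1" unfolding Z_def by (rule Suc.prems)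
  have IH: "fps_X ^ Suc N dvd A - Z"
    unfolding A_def Z_def
    by (rule Suc.IH[of "\<lambda>j. c (Suc j)" "\<lambda>j. Y (Suc j)"]) (rule Suc.prems)+
  have unit: "A * inverse A = 1" "Z * inverse Z = 1"
    using A0 Z0 by (simp_all add: inverse_mult_eq_1')
  have "q_neg_cf c (Suc N) - Y 0 = fps_X ^ (c 0 - 1) * (inverse Z - inverse A)"
    using Suc.prems(3)[of 0] A0 Z0
    by (simp add: fps_divide_unit right_diff_distrib flip: A_def Z_def)
  also have "inverse Z - inverse A = (A - Z) * (inverse A * inverse Z)"
    using unit by algebra
  finally have eq: "q_neg_cf c (Suc N) - Y 0 = fps_X ^ (c 0 - 1) * ((A - Z) * (inverse A * inverse Z))" .
  have "fps_X ^ 1 dvd (fps_X ^ (c 0 - 1) :: rat fps)"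
    using Suc.prems(1)[of 0] by (intro le_imp_power_dvd) simp
  then have "fps_X ^ 1 * fps_X ^ Suc N dvd q_neg_cf c (Suc N) - Y 0"
    unfolding eq by (intro mult_dvd_mono dvd_mult2 IH)
  then show ?case by simp
qed

lemma q_neg_cf_tendsto:
  assumes "\<And>j. c j \<ge> 2" "\<And>j. Y j $ 0 = 1"
    and "\<And>j. Y j = q_int (c j) - fps_X ^ (c j - 1) / Y (Suc j)"
  shows "q_neg_cf c \<longlonglongrightarrow> Y 0"
proof (rule tendsto_fpsI_dvd)
  fix N
  have "fps_X ^ Suc N dvd q_neg_cf c N - Y 0" using assms by (rule q_neg_cf_error)
  then show "fps_X ^ N dvd q_neg_cf c N - Y 0" by (rule power_le_dvd) simp
qed

section \<open>The recurrence of the q-Bessel values\<close>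

lemma q_fact_nth_0: "q_fact n $ 0 = 1"
proof (induction n)
  case 0
  show ?case by (simp add: q_fact_def)
next
  case (Suc n)
  then show ?case by (simp add: q_fact_def q_int_nth_0)
qed

lemma inverse_q_fact: "inverse (q_fact n) = q_int (Suc n) * inverse (q_fact (Suc n))"
proof -
  have "q_fact (Suc n) = q_fact n * q_int (Suc n)"
    by (simp add: q_fact_def)
  then show ?thesis
    by (simp add: fps_inverse_mult q_int_nth_0 inverse_mult_eq_1' mult_ac)
qed

text \<open>
  The factorials have constant term 1, so they are inverted as units; products with inverses,
  unlike quotients of power series, are open to ring normalisation.
\<close>
definition q_bessel_term :: "nat \<Rightarrow> nat \<Rightarrow> rat fps" where
  "q_bessel_term m n =
     (-1) ^ n * fps_X ^ (n * (n + m - 1)) * (inverse (q_fact n) * inverse (q_fact (n + m)))"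

lemma q_bessel_J_two_eq: "q_bessel_J_two m = suminf (q_bessel_term m)"
proof -
  have "(-1) ^ n * fps_X ^ (n * (n + m - 1)) / (q_fact n * q_fact (n + m)) = q_bessel_term m n" for n
    by (simp add: q_bessel_term_def fps_divide_unit q_fact_nth_0 fps_inverse_mult)
  then show ?thesis by (simp add: q_bessel_J_two_def)
qed

lemma q_bessel_J_two_partial_sum:
  assumes "m > 0"
  shows "fps_X ^ N dvd (\<Sum>n<N. q_bessel_term m n) - q_bessel_J_two m"
  unfolding q_bessel_J_two_eq
proof (rule suminf_fps_dvd)
  fix n
  have "n \<le> n * (n + m - 1)" using assms by (cases n) auto
  then have "fps_X ^ n dvd (fps_X ^ (n * (n + m - 1)) :: rat fps)"
    by (rule le_imp_power_dvd)
  then show "fps_X ^ n dvd q_bessel_term m n"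
    unfolding q_bessel_term_def by (intro dvd_mult2 dvd_mult)
qed

lemma q_bessel_J_two_nth_0:
  assumes "m > 0"
  shows "q_bessel_J_two m $ 0 = 1"
proof -
  have "q_bessel_J_two m $ 0 = (\<Sum>n<1. q_bessel_term m n) $ 0"
    using q_bessel_J_two_partial_sum[OF assms, of 1] unfolding fps_X_power_dvd_iff by simp
  also have "\<dots> = 1"
    by (simp add: q_bessel_term_def q_fact_nth_0)
  finally show ?thesis .
qed

lemma q_bessel_term_0:
  "q_bessel_term m 0 = q_int (Suc m) * q_bessel_term (Suc m) 0"
proof -
  have "inverse (q_fact 0) = 1" by (simp add: q_fact_def)
  then show ?thesis using inverse_q_fact[of m] by (simp add: q_bessel_term_def)
qed

text \<open>
  This is the numerator identity
  \<open>[k + m + 2]\<^sub>q = [k + 1]\<^sub>q + q\<^sup>k\<^sup>+\<^sup>1 [m + 1]\<^sub>q\<close> over the common denominator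
  \<open>[k + 1]\<^sub>q! [k + m + 2]\<^sub>q!\<close>. The powers of \<open>q\<close> match because
  \<open>(k + 1) (k + m) = k (k + m + 1) + m\<close>.
\<close>
lemma q_bessel_term_Suc:
  "q_bessel_term m (Suc k) =
     q_int (Suc m) * q_bessel_term (Suc m) (Suc k) - fps_X ^ m * q_bessel_term (m + 2) k"
proof -
  define C where "C = inverse (q_fact (Suc k)) * inverse (q_fact (k + m + 2))"
  define E where "E = (fps_X ^ (k * (k + m + 1)) :: rat fps)"
  have t1: "q_bessel_term m (Suc k) = (-1) ^ Suc k * (E * fps_X ^ m) * (q_int (k + m + 2) * C)"
    using inverse_q_fact[of "Suc k + m"]
    by (simp add: q_bessel_term_def C_def E_def algebra_simps power_add)
  have t2: "q_bessel_term (Suc m) (Suc k) = (-1) ^ Suc k * (E * fps_X ^ m * fps_X ^ Suc k) * C"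
    by (simp add: q_bessel_term_def C_def E_def algebra_simps power_add)
  have t3: "q_bessel_term (m + 2) k = (-1) ^ k * E * (q_int (Suc k) * C)"
    using inverse_q_fact[of k]
    by (simp add: q_bessel_term_def C_def E_def algebra_simps)
  have "q_int (k + m + 2) = q_int (Suc k) + fps_X ^ Suc k * q_int (Suc m)"
    using q_int_add[of "Suc k" "Suc m"] by simp
  then show ?thesis unfolding t1 t2 t3 by (simp add: algebra_simps)
qed

text \<open>
  The shift of the index makes the last sum one term shorter.
\<close>
lemma q_bessel_partial_sum_recurrence:
  "(\<Sum>n<Suc N. q_bessel_term m n) =
     q_int (Suc m) * (\<Sum>n<Suc N. q_bessel_term (Suc m) n)
       - fps_X ^ m * (\<Sum>n<N. q_bessel_term (m + 2) n)"
proof (induction N)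
  case 0
  show ?case by (simp add: q_bessel_term_0[of m])
next
  case (Suc N)
  show ?case
    unfolding sum.lessThan_Suc[of _ "Suc N"] sum.lessThan_Suc[of "q_bessel_term (m + 2)" N]
      Suc.IH q_bessel_term_Suc[of m N]
    by (simp add: algebra_simps del: sum.lessThan_Suc)
qed

text \<open>
  The two sides agree modulo every power of \<open>q\<close>, since the partial sums satisfy the recurrence
  exactly and approximate the values to any order.
\<close>
lemma q_bessel_J_two_recurrence:
  assumes "m > 0"
  shows "q_bessel_J_two m =
    q_int (Suc m) * q_bessel_J_two (Suc m) - fps_X ^ m * q_bessel_J_two (m + 2)"
proof (rule fps_eqI_dvd)
  fix N
  define S where "S m N = (\<Sum>n<N. q_bessel_term m n)" for m N
  have err: "fps_X ^ N dvd S m' N' - q_bessel_J_two m'" if "m' > 0" "N \<le> N'" for m' N'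
    unfolding S_def using q_bessel_J_two_partial_sum[OF that(1), of N'] that(2) by (rule power_le_dvd)
  have "fps_X ^ N dvd q_int (Suc m) * (S (Suc m) (Suc N) - q_bessel_J_two (Suc m))
      - fps_X ^ m * (S (m + 2) N - q_bessel_J_two (m + 2)) - (S m (Suc N) - q_bessel_J_two m)"
    by (rule dvd_diff[OF dvd_diff[OF dvd_mult[OF err] dvd_mult[OF err]] err])
      (use assms in simp_all)
  also have "\<dots> = q_bessel_J_two m
      - (q_int (Suc m) * q_bessel_J_two (Suc m) - fps_X ^ m * q_bessel_J_two (m + 2))"
    using q_bessel_partial_sum_recurrence[of m N]
    by (simp add: S_def algebra_simps del: sum.lessThan_Suc)
  finally show "fps_X ^ N dvd \<dots>" .
qed

lemma q_bessel_quotient_tendsto: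
  "q_neg_cf (\<lambda>j. j + 2) \<longlonglongrightarrow> q_bessel_J_two 1 / q_bessel_J_two 2"
proof -
  define Y where "Y j = q_bessel_J_two (Suc j) / q_bessel_J_two (j + 2)" for j
  have nth_0: "q_bessel_J_two (Suc j) $ 0 = 1" for j
    by (rule q_bessel_J_two_nth_0) simp
  have Y_nth_0: "Y j $ 0 = 1" for j by (simp add: Y_def nth_0)
  have step: "Y j = q_int (j + 2) - fps_X ^ (j + 2 - 1) / Y (Suc j)" for j
  proof -
    define A B D where "A = q_bessel_J_two (Suc j)" and "B = q_bessel_J_two (j + 2)"
      and "D = q_bessel_J_two (j + 3)"
    have nz: "B $ 0 = 1" "D $ 0 = 1"
      using nth_0[of "Suc j"] nth_0[of "j + 2"] by (simp_all add: B_def D_def eval_nat_numeral)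
    have rec: "A = q_int (j + 2) * B - fps_X ^ Suc j * D"
      using q_bessel_J_two_recurrence[of "Suc j"] by (simp add: A_def B_def D_def eval_nat_numeral)
    have "fps_X ^ Suc j / (B / D) = fps_X ^ Suc j * (D * inverse B)"
      using nz by (simp add: fps_divide_unit fps_inverse_mult mult_ac)
    moreover have "A / B = q_int (j + 2) * (B * inverse B) - fps_X ^ Suc j * (D * inverse B)"
      using nz by (simp add: rec fps_divide_unit algebra_simps)
    moreover have "B * inverse B = 1" using nz by (simp add: inverse_mult_eq_1')
    ultimately show ?thesis by (simp add: Y_def A_def B_def D_def eval_nat_numeral)
  qed
  have "q_neg_cf (\<lambda>j. j + 2) \<longlonglongrightarrow> Y 0"
    by (rule q_neg_cf_tendsto[where Y = Y]) (simp, rule Y_nth_0, rule step)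
  then show ?thesis by (simp add: Y_def numeral_2_eq_2)
qed

theorem proposition3p2:
  "q_real (bessel_J 1 2 / bessel_J 2 2) = q_bessel_J_two 1 / q_bessel_J_two 2"
proof -
  have "(THE c. is_neg_cf_expansion c (bessel_J 1 2 / bessel_J 2 2)) = (\<lambda>j. j + 2)"
    using bessel_quotient_expansion is_neg_cf_expansion_unique by (intro the_equality) auto
  then show ?thesis
    using limI[OF q_bessel_quotient_tendsto] by (simp add: q_real_def)
qed

end
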